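(* Let $P_X$ and $P_Y$ be two probability distributions on $\{-1,1\}$, and let $\mathcal{U}=\mathcal{V}=\mathcal{Z}=\{-1,1\}$. Then $\mathcal{P}_{EA}(P_XP_Y,\mathcal{U},\mathcal{V},\mathcal{Z})=\mathcal{P}_{CR}(P_XP_Y,\mathcal{U},\mathcal{V})$, where $P_XP_Y$ denotes the product distribution on $\{-1,1\}^2$.
   Context: Let $P_{X,Y}$ be a distribution on $\{-1,1\}^2$, and let $\mathcal{U},\mathcal{V}$ be finite sets. For $d\in\mathbb{N}$, $(X^d,Y^d)=((X_1,Y_1),\dots,(X_d,Y_d))$ is i.i.d. with law $P_{X,Y}$. A stochastic function is a function whose output may also depend on private randomness, independent of everything else (in particular, the private randomness of Alice and that of Bob are independent); equivalently, a Markov kernel from inputs to outputs. $d_{TV}$ is total variation distance. Entanglement-assisted simulation (EA-NISS). The Bell state is $|\Phi^+\rangle=\frac{1}{\sqrt2}(|00\rangle+|11\rangle)\in\mathbb{C}^2\otimes\mathbb{C}^2$. A measurement with finite outcome set $\mathcal{Z}$ is a family $(\Lambda_z)_{z\in\mathcal{Z}}$ of positive semidefinite Hermitian $2\times2$ matrices with $\sum_z\Lambda_z=\mathbb{I}$. If Alice and Bob apply measurements $(\Lambda_{1,z})_z$ and $(\Lambda_{2,z})_z$ to their halves of $|\Phi^+\rangle$, their outcomes $(Z_1,Z_2)$ have law $P(Z_1=z_1,Z_2=z_2)=\langle\Phi^+|\Lambda_{1,z_1}\otimes\Lambda_{2,z_2}|\Phi^+\rangle$, and $(Z_1,Z_2)$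 is independent of $(X^d,Y^d)$. For a finite set $\mathcal{Z}$, $\mathcal{P}_{EA}(P_{X,Y},\mathcal{U},\mathcal{V},\mathcal{Z})$ is the set of distributions $Q_{U,V}$ on $\mathcal{U}\times\mathcal{V}$ for which there exist, for each $d\in\mathbb{N}$, measurements $(\Lambda_{d,1,z})_{z\in\mathcal{Z}}$, $(\Lambda_{d,2,z})_{z\in\mathcal{Z}}$ with outcomes $Z_{1,d},Z_{2,d}$, and (possibly stochastic) functions $f_d:\mathcal{Z}\times\{-1,1\}^d\to\mathcal{U}$, $g_d:\mathcal{Z}\times\{-1,1\}^d\to\mathcal{V}$, such that the law $P^{(d)}$ of $(f_d(Z_{1,d},X^d),g_d(Z_{2,d},Y^d))$ satisfies $\lim_{d\to\infty}d_{TV}(P^{(d)},Q_{U,V})=0$. Common-randomness simulation (CR-NISS). $\mathcal{P}_{CR}(P_{X,Y},\mathcal{U},\mathcal{V})$ is the set of distributions $Q_{U,V}$ on $\mathcal{U}\times\mathcal{V}$ for which there exist, for each $d\in\mathbb{N}$, (possibly stochastic) functions $f_d:\{-1,1\}^{d+1}\to\mathcal{U}$ and $g_d:\{-1,1\}^{d+1}\to\mathcal{V}$ such that the law $P^{(d)}$ of $(f_d(Z,X^d),g_d(Z,Y^d))$ satisfies $\lim_{d\to\infty}d_{TV}(P^{(d)},Q_{U,V})=0$, where $Z$ is uniform on $\{-1,1\}$ and independent of $(X^d,Y^d)$. *)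

theory Defs
  imports "HOL-Probability.Probability"
begin

text \<open>
  Finite alphabets are sets, distributions on them are probability mass functions whose support
  lies in the set, and a stochastic function from \<open>A\<close> to \<open>B\<close> is a Markov kernel: a
  map into probability mass functions, constrained on \<open>A\<close> only.
\<close>

definition distributions_on :: "'a set \<Rightarrow> 'a pmf set" where
  "distributions_on A = {Q. set_pmf Q \<subseteq> A}"

definition stochastic_functions :: "'a set \<Rightarrow> 'b set \<Rightarrow> ('a \<Rightarrow> 'b pmf) set" where
  "stochastic_functions A B = {f. \<forall>a\<in>A. f a \<in> distributions_on B}"

definition d_TV :: "'a pmf \<Rightarrow> 'a pmf \<Rightarrow> real" where
  "d_TV P Q = (SUP A. \<bar>measure_pmf.prob P A - measure_pmf.prob Q A\<bar>)"

definition signs :: "int set" where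
  "signs = {-1, 1}"

definition sign_seqs :: "nat \<Rightarrow> int list set" where
  "sign_seqs d = {xs. length xs = d \<and> set xs \<subseteq> signs}"


definition cinner :: "complex ^ 'n::finite \<Rightarrow> complex ^ 'n \<Rightarrow> complex" where
  "cinner v w = (\<Sum>i\<in>UNIV. cnj (v $ i) * w $ i)"

definition hermitian :: "complex ^ 'n ^ 'n::finite \<Rightarrow> bool" where
  "hermitian A \<longleftrightarrow> (\<forall>i j. A $ i $ j = cnj (A $ j $ i))"

definition pos_semidef :: "complex ^ 'n ^ 'n::finite \<Rightarrow> bool" where
  "pos_semidef A \<longleftrightarrow> hermitian A \<and> (\<forall>v. 0 \<le> Re (cinner v (A *v v)))"

text \<open>The tensor product of coordinate spaces is the space indexed by pairs.\<close>

definition tensor_vec ::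
    "complex ^ 'm::finite \<Rightarrow> complex ^ 'n::finite \<Rightarrow> complex ^ ('m \<times> 'n)" where
  "tensor_vec v w = (\<chi> p. v $ fst p * w $ snd p)"

definition tensor_mat ::
    "complex ^ 'm ^ 'm::finite \<Rightarrow> complex ^ 'n ^ 'n::finite
      \<Rightarrow> complex ^ ('m \<times> 'n) ^ ('m \<times> 'n)" where
  "tensor_mat A B = (\<chi> p q. A $ fst p $ fst q * B $ snd p $ snd q)"

text \<open>The two elements of the index type \<open>2\<close> are \<open>0\<close> and \<open>1\<close> (here \<open>2 = 0\<close>).\<close>

definition ket :: "2 \<Rightarrow> complex ^ 2" where
  "ket i = axis i 1"

definition bell :: "complex ^ (2 \<times> 2)" where
  "bell = (1 / sqrt 2) *\<^sub>R (tensor_vec (ket 0) (ket 0) + tensor_vec (ket 1) (ket 1))"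

definition measurements :: "'z set \<Rightarrow> ('z \<Rightarrow> complex ^ 2 ^ 2) set" where
  "measurements Z = {L. (\<forall>z\<in>Z. pos_semidef (L z)) \<and> (\<Sum>z\<in>Z. L z) = mat 1}"

definition bell_prob :: "complex ^ 2 ^ 2 \<Rightarrow> complex ^ 2 ^ 2 \<Rightarrow> real" where
  "bell_prob A B = Re (cinner bell (tensor_mat A B *v bell))"

text \<open>
  \<^const>\<open>embed_pmf\<close> is only meaningful for nonnegative functions with total mass one; the lemma
  \<open>pmf_outcome_law\<close> below shows that this is the case whenever \<open>L1\<close> and \<open>L2\<close> are measurements.
\<close>

definition outcome_law ::
    "'z set \<Rightarrow> ('z \<Rightarrow> complex ^ 2 ^ 2) \<Rightarrow> ('z \<Rightarrow> complex ^ 2 ^ 2) \<Rightarrow> ('z \<times> 'z) pmf" where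
  "outcome_law Z L1 L2 =
     embed_pmf (\<lambda>(z1, z2). if z1 \<in> Z \<and> z2 \<in> Z then bell_prob (L1 z1) (L2 z2) else 0)"


lemma bell_nth: "bell $ (i, j) = (if i = j then complex_of_real (1 / sqrt 2) else 0)"
proof -
  have "k = 0 \<or> k = 1" for k :: 2
    using exhaust_2[of k] by auto
  then have "i = 0 \<or> i = 1" "j = 0 \<or> j = 1" by blast+
  then show ?thesis
    unfolding bell_def vector_scaleR_component
    by (auto simp: tensor_vec_def ket_def axis_def scaleR_conv_of_real)
qed

lemma cinner_bell:
  "cinner bell (tensor_mat A B *v bell) = (\<Sum>i\<in>UNIV. \<Sum>j\<in>UNIV. A $ i $ j * B $ i $ j) / 2"
proof -
  have half:
    "cnj (complex_of_real (1 / sqrt 2)) * (x * complex_of_real (1 / sqrt 2)) = x / 2" for x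
  proof -
    have "complex_of_real (1 / sqrt 2) * complex_of_real (1 / sqrt 2) = 1 / 2"
      by (simp flip: of_real_mult)
    then show ?thesis
      by (simp add: mult.left_commute mult.assoc del: of_real_divide)
  qed
  have "cinner bell (tensor_mat A B *v bell) =
      (\<Sum>i\<in>UNIV. \<Sum>i'\<in>UNIV. cnj (bell $ (i, i')) *
         (\<Sum>j\<in>UNIV. \<Sum>j'\<in>UNIV. A $ i $ j * B $ i' $ j' * bell $ (j, j')))"
    by (simp add: cinner_def matrix_vector_mult_def tensor_mat_def sum.cartesian_product
        flip: UNIV_Times_UNIV)
       (simp add: case_prod_beta)
  also have "\<dots> = (\<Sum>i\<in>UNIV. \<Sum>j\<in>UNIV. A $ i $ j * B $ i $ j / 2)"
    by (simp add: bell_nth sum_2 distrib_left half if_distrib[of cnj] cong: if_cong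
        del: of_real_divide complex_cnj_complex_of_real)
  finally show ?thesis
    by (simp add: sum_divide_distrib)
qed

lemma pos_semidef_2:
  fixes A :: "complex ^ 2 ^ 2"
  assumes "pos_semidef A"
  shows "Im (A $ 1 $ 1) = 0" "Im (A $ 2 $ 2) = 0" "A $ 2 $ 1 = cnj (A $ 1 $ 2)"
    and "0 \<le> Re (A $ 1 $ 1)" "0 \<le> Re (A $ 2 $ 2)"
    and "(cmod (A $ 1 $ 2))\<^sup>2 \<le> Re (A $ 1 $ 1) * Re (A $ 2 $ 2)"
proof -
  define a b d where "a = A $ 1 $ 1" and "b = A $ 1 $ 2" and "d = A $ 2 $ 2"
  have herm: "A $ i $ j = cnj (A $ j $ i)" for i j
    using assms unfolding pos_semidef_def hermitian_def by blast
  show im: "Im (A $ 1 $ 1) = 0" "Im (A $ 2 $ 2) = 0"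
    using herm[of 1 1] herm[of 2 2] by (metis cnj.simps(2) equal_neg_zero)+
  show c: "A $ 2 $ 1 = cnj (A $ 1 $ 2)" by (rule herm)
  have quad: "0 \<le> Re (cnj x * (a * x + b * y) + cnj y * (cnj b * x + d * y))" for x y
  proof -
    have "0 \<le> Re (cinner (vector [x, y]) (A *v vector [x, y]))"
      using assms unfolding pos_semidef_def by blast
    then show ?thesis
      by (simp add: cinner_def matrix_vector_mult_def sum_2 a_def b_def d_def c)
  qed
  show a0: "0 \<le> Re (A $ 1 $ 1)" and d0: "0 \<le> Re (A $ 2 $ 2)"
    using quad[of 1 0] quad[of 0 1] by (simp_all add: a_def d_def)
  show "(cmod (A $ 1 $ 2))\<^sup>2 \<le> Re (A $ 1 $ 1) * Re (A $ 2 $ 2)"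
  proof (cases "Re d = 0")
    case True
    define n where "n = (cmod b)\<^sup>2"
    have n: "n = Re b * Re b + Im b * Im b"
      unfolding n_def cmod_power2 by (simp add: power2_eq_square)
    have "0 \<le> Re a - 2 * t * n" for t :: real
      using quad[of 1 "- of_real t * cnj b"] True im(2)
      by (simp add: n d_def algebra_simps)
    from this[of "(Re a + 1) / (2 * n)"] have "n = 0"
      by (cases "n = 0") (auto simp: field_simps)
    then show ?thesis using True by (simp add: n_def b_def d_def)
  next
    case False
    have "0 \<le> Re d * (Re a * Re d - (cmod b)\<^sup>2)"
      using quad[of d "- cnj b"] im
      by (simp add: a_def d_def cmod_power2 algebra_simps) (simp add: power2_eq_square algebra_simps)
    then show ?thesis
      using False d0 by (simp add: zero_le_mult_iff a_def b_def d_def)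
  qed
qed

lemma bell_prob_nonneg:
  assumes "pos_semidef A" "pos_semidef B"
  shows "0 \<le> bell_prob A B"
proof -
  note A = pos_semidef_2[OF assms(1)] and B = pos_semidef_2[OF assms(2)]
  define a d a' d' where "a = Re (A $ 1 $ 1)" "d = Re (A $ 2 $ 2)"
    "a' = Re (B $ 1 $ 1)" "d' = Re (B $ 2 $ 2)"
  define w where "w = A $ 1 $ 2 * B $ 1 $ 2"
  have nn: "0 \<le> a" "0 \<le> d" "0 \<le> a'" "0 \<le> d'"
    using A B by (simp_all add: a_d_a'_d'_def)
  have "(2 * cmod w)\<^sup>2 \<le> 4 * ((a * d) * (a' * d'))"
    using mult_mono[OF A(6) B(6)] nn
    by (simp add: w_def norm_mult power_mult_distrib a_d_a'_d'_def)
  also have "\<dots> \<le> (a * a' + d * d')\<^sup>2"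
    using zero_le_power2[of "a * a' - d * d'"] by (simp add: power2_eq_square algebra_simps)
  finally have "2 * cmod w \<le> a * a' + d * d'"
    by (rule power2_le_imp_le) (simp add: nn)
  then have "0 \<le> a * a' + d * d' + 2 * Re w"
    using abs_Re_le_cmod[of w] by linarith
  also have "\<dots> = 2 * bell_prob A B"
    using A B by (simp add: bell_prob_def cinner_bell sum_2 w_def a_d_a'_d'_def)
  finally show ?thesis by simp
qed

lemma pmf_outcome_law:
  assumes "finite Z" "L1 \<in> measurements Z" "L2 \<in> measurements Z"
  shows "pmf (outcome_law Z L1 L2) (z1, z2) =
    (if z1 \<in> Z \<and> z2 \<in> Z then bell_prob (L1 z1) (L2 z2) else 0)"
proof -
  let ?f = "\<lambda>(z1, z2). if z1 \<in> Z \<and> z2 \<in> Z then bell_prob (L1 z1) (L2 z2) else 0"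
  have nonneg: "0 \<le> ?f p" for p
    using assms by (auto simp: measurements_def intro: bell_prob_nonneg split: prod.splits)
  have entry: "(\<Sum>z\<in>Z. L z $ i $ j) = (if i = j then 1 else 0)"
    if "L \<in> measurements Z" for L i j
  proof -
    have "(\<Sum>z\<in>Z. L z $ i $ j) = (\<Sum>z\<in>Z. L z) $ i $ j" by simp
    then show ?thesis using that by (simp add: measurements_def mat_def del: sum_component)
  qed
  have "(\<Sum>p\<in>Z \<times> Z. ?f p) = (\<Sum>z1\<in>Z. \<Sum>z2\<in>Z. bell_prob (L1 z1) (L2 z2))"
    by (simp add: sum.cartesian_product case_prod_beta mem_Times_iff)
  also have "\<dots> = Re (\<Sum>z1\<in>Z. \<Sum>z2\<in>Z. (\<Sum>i\<in>UNIV. \<Sum>j\<in>UNIV. L1 z1 $ i $ j * L2 z2 $ i $ j) / 2)"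
    by (simp add: bell_prob_def cinner_bell)
  also have "(\<Sum>z1\<in>Z. \<Sum>z2\<in>Z. (\<Sum>i\<in>UNIV. \<Sum>j\<in>UNIV. L1 z1 $ i $ j * L2 z2 $ i $ j) / 2) =
      (\<Sum>i\<in>UNIV. \<Sum>j\<in>UNIV. (\<Sum>z1\<in>Z. L1 z1 $ i $ j) * (\<Sum>z2\<in>Z. L2 z2 $ i $ j)) / 2"
    unfolding sum_2 sum_product sum.distrib sum_divide_distrib[symmetric] by simp
  also have "Re \<dots> = 1"
    by (simp add: entry assms sum_2)
  finally have one: "(\<Sum>p\<in>Z \<times> Z. ?f p) = 1" .
  have "(\<integral>\<^sup>+p. ennreal (?f p) \<partial>count_space UNIV) = (\<Sum>p\<in>Z \<times> Z. ennreal (?f p))"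
    using assms(1) by (intro nn_integral_count_space') (auto split: if_splits)
  also have "\<dots> = 1"
    using one nonneg by (subst sum_ennreal) auto
  finally show ?thesis
    unfolding outcome_law_def using nonneg by (subst pmf_embed_pmf) auto
qed


text \<open>
  The independence of the two private randomness sources, given the inputs, is expressed by
  \<^const>\<open>pair_pmf\<close> of the two kernel outputs.
\<close>

definition EA_law ::
    "(int \<times> int) pmf \<Rightarrow> 'z set \<Rightarrow> nat \<Rightarrow> ('z \<Rightarrow> complex ^ 2 ^ 2) \<Rightarrow> ('z \<Rightarrow> complex ^ 2 ^ 2)
      \<Rightarrow> ('z \<times> int list \<Rightarrow> 'u pmf) \<Rightarrow> ('z \<times> int list \<Rightarrow> 'v pmf) \<Rightarrow> ('u \<times> 'v) pmf" where
  "EA_law P Z d L1 L2 f g =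
     bind_pmf (pair_pmf (outcome_law Z L1 L2) (replicate_pmf d P))
       (\<lambda>((z1, z2), xys). pair_pmf (f (z1, map fst xys)) (g (z2, map snd xys)))"

definition P_EA ::
    "(int \<times> int) pmf \<Rightarrow> 'u set \<Rightarrow> 'v set \<Rightarrow> 'z set \<Rightarrow> ('u \<times> 'v) pmf set" where
  "P_EA P U V Z =
     {Q \<in> distributions_on (U \<times> V).
        \<exists>(L1 :: nat \<Rightarrow> 'z \<Rightarrow> complex ^ 2 ^ 2) (L2 :: nat \<Rightarrow> 'z \<Rightarrow> complex ^ 2 ^ 2) f g.
          (\<forall>d. L1 d \<in> measurements Z \<and> L2 d \<in> measurements Z \<and>
               f d \<in> stochastic_functions (Z \<times> sign_seqs d) U \<and>
               g d \<in> stochastic_functions (Z \<times> sign_seqs d) V) \<and>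
          (\<lambda>d. d_TV (EA_law P Z d (L1 d) (L2 d) (f d) (g d)) Q) \<longlonglongrightarrow> 0}"

definition CR_law ::
    "(int \<times> int) pmf \<Rightarrow> nat \<Rightarrow> (int list \<Rightarrow> 'u pmf) \<Rightarrow> (int list \<Rightarrow> 'v pmf) \<Rightarrow> ('u \<times> 'v) pmf" where
  "CR_law P d f g =
     bind_pmf (pair_pmf (pmf_of_set signs) (replicate_pmf d P))
       (\<lambda>(z, xys). pair_pmf (f (z # map fst xys)) (g (z # map snd xys)))"

definition P_CR :: "(int \<times> int) pmf \<Rightarrow> 'u set \<Rightarrow> 'v set \<Rightarrow> ('u \<times> 'v) pmf set" where
  "P_CR P U V =
     {Q \<in> distributions_on (U \<times> V).
        \<exists>f g.
          (\<forall>d. f d \<in> stochastic_functions (sign_seqs (d + 1)) U \<and>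
               g d \<in> stochastic_functions (sign_seqs (d + 1)) V) \<and>
          (\<lambda>d. d_TV (CR_law P d (f d) (g d)) Q) \<longlonglongrightarrow> 0}"

end

theory Submission
  imports Defs
begin

text \<open>
  For a product source, \<open>X\<^sup>d\<close> and \<open>Y\<^sup>d\<close> act as additional private randomness, so
  for every \<open>d\<close> only the correlation produced from the outcomes of the measurements (or from
  the shared bit) matters. Postprocessing the outcomes turns the measurements into two-outcome
  ones, say \<open>(A, I - A)\<close> and \<open>(B, I - B)\<close>. Splitting off the traces \<open>2m\<close> and
  \<open>2m'\<close>, the probability that both first outcomes occur is \<open>m m' + c\<close>, where
  \<open>\<bar>c\<bar> \<le> s s'\<close> by Cauchy-Schwarz and the eigenvalues of \<open>A\<close> and \<open>B\<close> are
  \<open>m \<plusminus> s\<close> and \<open>m' \<plusminus> s'\<close>. A shared bit achieves this with the success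
  probabilities \<open>m \<plusminus> s\<close> and \<open>m' \<plusminus> c / s\<close> (with \<open>c / 0 = 0\<close>), all of which lie in \<open>[0, 1]\<close>.
  Conversely, measuring the Bell state in the standard basis on both sides yields a shared bit.
\<close>

section \<open>Bilinearity of Bell probabilities and the positive semidefinite cone\<close>

lemma bell_prob_add_left: "bell_prob (A + B) C = bell_prob A C + bell_prob B C"
  by (simp add: bell_prob_def cinner_bell sum_2 algebra_simps add_divide_distrib)

lemma bell_prob_add_right: "bell_prob A (B + C) = bell_prob A B + bell_prob A C"
  by (simp add: bell_prob_def cinner_bell sum_2 algebra_simps add_divide_distrib)

lemma bell_prob_scaleR_left: "bell_prob (r *\<^sub>R A) B = r * bell_prob A B"
  by (simp add: bell_prob_def cinner_bell sum_2 algebra_simps add_divide_distrib)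

lemma bell_prob_scaleR_right: "bell_prob A (r *\<^sub>R B) = r * bell_prob A B"
  by (simp add: bell_prob_def cinner_bell sum_2 algebra_simps add_divide_distrib)

lemma pos_semidef_add:
  assumes "pos_semidef A" "pos_semidef B"
  shows "pos_semidef (A + B)"
proof -
  have "cinner v ((A + B) *v v) = cinner v (A *v v) + cinner v (B *v v)" for v
    by (simp add: cinner_def matrix_vector_mult_add_rdistrib distrib_left sum.distrib)
  then show ?thesis
    using assms unfolding pos_semidef_def hermitian_def
    by (metis (no_types, lifting) add_nonneg_nonneg complex_cnj_add plus_complex.sel(1)
        vector_add_component)
qed

lemma pos_semidef_scaleR:
  assumes "pos_semidef A" "0 \<le> r"
  shows "pos_semidef (r *\<^sub>R A)"
proof -
  have "cinner v ((r *\<^sub>R A) *v v) = r *\<^sub>R cinner v (A *v v)" for v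
    by (simp add: cinner_def matrix_vector_mult_def flip: scaleR_sum_right)
  moreover have "hermitian (r *\<^sub>R A)"
    using assms(1) unfolding pos_semidef_def hermitian_def
    by (metis complex_cnj_scaleR vector_scaleR_component)
  ultimately show ?thesis
    using assms by (simp add: pos_semidef_def)
qed

section \<open>Two-outcome effects on the Bell state against a shared bit\<close>

text \<open>Since \<open>s\<close> squared is \<open>m\<close> squared minus det A, the first bound
  is det A \<ge> 0. The second is the same determinant condition for \<open>mat 1 - A\<close>, which
  has mean \<open>1 - m\<close> and the same \<open>s\<close>.\<close>

lemma effect_deviation_bound:
  fixes A :: "complex ^ 2 ^ 2"
  assumes "pos_semidef A" "pos_semidef (mat 1 - A)"
  defines "m \<equiv> (Re (A $ 1 $ 1) + Re (A $ 2 $ 2)) / 2"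
    and "s \<equiv> sqrt (((Re (A $ 1 $ 1) - Re (A $ 2 $ 2)) / 2)\<^sup>2 + (cmod (A $ 1 $ 2))\<^sup>2)"
  shows "s \<le> m" "s \<le> 1 - m"
proof -
  note A = pos_semidef_2[OF assms(1)] and B = pos_semidef_2[OF assms(2)]
  have "s\<^sup>2 = ((Re (A $ 1 $ 1) - Re (A $ 2 $ 2)) / 2)\<^sup>2 + (cmod (A $ 1 $ 2))\<^sup>2"
    by (simp add: s_def)
  then have s: "s\<^sup>2 = m\<^sup>2 - Re (A $ 1 $ 1) * Re (A $ 2 $ 2) + (cmod (A $ 1 $ 2))\<^sup>2"
    by (simp add: m_def power2_eq_square field_simps)
  show "s \<le> m"
  proof (rule power2_le_imp_le)
    show "s\<^sup>2 \<le> m\<^sup>2" using s A(6) by simp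
    show "0 \<le> m" using A by (simp add: m_def)
  qed
  show "s \<le> 1 - m"
  proof (rule power2_le_imp_le)
    have "(cmod (A $ 1 $ 2))\<^sup>2 \<le> (1 - Re (A $ 1 $ 1)) * (1 - Re (A $ 2 $ 2))"
      using B(6) by (simp add: mat_def)
    then show "s\<^sup>2 \<le> (1 - m)\<^sup>2"
      unfolding s by (simp add: m_def power2_eq_square field_simps)
    show "0 \<le> 1 - m" using B by (simp add: m_def mat_def)
  qed
qed

lemma shared_bit_parameters:
  fixes m m' s s' c :: real
  assumes "s \<le> m" "s \<le> 1 - m" "s' \<le> m'" "s' \<le> 1 - m'" "0 \<le> s" "0 \<le> s'" "\<bar>c\<bar> \<le> s * s'"
  obtains p q :: "bool \<Rightarrow> real"
  where "\<And>b. p b \<in> {0..1}" "\<And>b. q b \<in> {0..1}"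
    "p True + p False = 2 * m" "q True + q False = 2 * m'"
    "p True * q True + p False * q False = 2 * (m * m' + c)"
proof
  \<comment> \<open>The deviations \<open>s\<close> and \<open>t\<close> have to satisfy
    \<open>s * t = c\<close>. If \<open>s = 0\<close>, the bound on \<open>c\<close> forces
    \<open>c = 0\<close>, and division by zero gives \<open>t = 0\<close>, so the identity
    survives.\<close>
  define t where "t = c / s"
  have st: "s * t = c" using assms by (cases "s = 0") (auto simp: t_def)
  have t: "\<bar>t\<bar> \<le> s'"
    using assms by (cases "s = 0") (auto simp: t_def divide_le_eq mult.commute)
  let ?p = "\<lambda>b. if b then m + s else m - s" and ?q = "\<lambda>b. if b then m' + t else m' - t"
  show "?p b \<in> {0..1}" "?q b \<in> {0..1}" for b
    using assms t by auto
  show "?p True + ?p False = 2 * m" "?q True + ?q False = 2 * m'" by simp_all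
  show "?p True * ?q True + ?p False * ?q False = 2 * (m * m' + c)"
    by (simp add: st[symmetric] algebra_simps)
qed

text \<open>Writing the diagonals as \<open>m + x\<close>, \<open>m - x\<close> and
  \<open>m' + x'\<close>, \<open>m' - x'\<close>, half the sum of the entrywise products of
  \<open>A\<close> and \<open>B\<close> has real part \<open>m * m' + c\<close>, with
  \<open>c\<close> as defined in the proof. Taking one effect to be \<open>mat 1\<close> leaves only
  the mean of the other.\<close>

lemma bell_prob_effects_shared_bit:
  assumes A: "pos_semidef A" "pos_semidef (mat 1 - A)"
    and B: "pos_semidef B" "pos_semidef (mat 1 - B)"
  obtains p q :: "bool \<Rightarrow> real"
  where "\<And>b. p b \<in> {0..1}" "\<And>b. q b \<in> {0..1}"
    "bell_prob A (mat 1) = (p True + p False) / 2"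
    "bell_prob (mat 1) B = (q True + q False) / 2"
    "bell_prob A B = (p True * q True + p False * q False) / 2"
proof -
  define m x s where "m = (Re (A $ 1 $ 1) + Re (A $ 2 $ 2)) / 2"
    and "x = (Re (A $ 1 $ 1) - Re (A $ 2 $ 2)) / 2"
    and "s = sqrt (x\<^sup>2 + (cmod (A $ 1 $ 2))\<^sup>2)"
  define m' x' s' where "m' = (Re (B $ 1 $ 1) + Re (B $ 2 $ 2)) / 2"
    and "x' = (Re (B $ 1 $ 1) - Re (B $ 2 $ 2)) / 2"
    and "s' = sqrt (x'\<^sup>2 + (cmod (B $ 1 $ 2))\<^sup>2)"
  define c where "c = x * x' + Re (A $ 1 $ 2 * B $ 1 $ 2)"
  \<comment> \<open>Cauchy-Schwarz in the plane, applied to the moduli of the diagonal deviation and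
    of the off-diagonal entry. The defect is the square of a 2 by 2 determinant.\<close>
  have "\<bar>c\<bar> \<le> \<bar>x\<bar> * \<bar>x'\<bar> + cmod (A $ 1 $ 2) * cmod (B $ 1 $ 2)"
    using abs_triangle_ineq[of "x * x'" "Re (A $ 1 $ 2 * B $ 1 $ 2)"]
      abs_Re_le_cmod[of "A $ 1 $ 2 * B $ 1 $ 2"]
    by (simp add: c_def abs_mult norm_mult)
  also have "\<dots> \<le> s * s'"
  proof (rule power2_le_imp_le)
    let ?b = "cmod (A $ 1 $ 2)" and ?b' = "cmod (B $ 1 $ 2)"
    have "(\<bar>x\<bar> * \<bar>x'\<bar> + ?b * ?b')\<^sup>2 \<le> (\<bar>x\<bar>\<^sup>2 + ?b\<^sup>2) * (\<bar>x'\<bar>\<^sup>2 + ?b'\<^sup>2)"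
      using zero_le_power2[of "\<bar>x\<bar> * ?b' - \<bar>x'\<bar> * ?b"]
      by (simp add: power2_eq_square algebra_simps)
    also have "\<dots> = (s * s')\<^sup>2"
      by (simp add: power_mult_distrib s_def s'_def)
    finally show "(\<bar>x\<bar> * \<bar>x'\<bar> + ?b * ?b')\<^sup>2 \<le> (s * s')\<^sup>2" .
  qed (simp add: s_def s'_def)
  finally have c: "\<bar>c\<bar> \<le> s * s'" .
  have "s \<le> m" "s \<le> 1 - m" "s' \<le> m'" "s' \<le> 1 - m'" "0 \<le> s" "0 \<le> s'"
    using effect_deviation_bound[OF A] effect_deviation_bound[OF B]
    by (simp_all add: m_def s_def x_def m'_def s'_def x'_def)
  then obtain p q :: "bool \<Rightarrow> real" where pq: "\<And>b. p b \<in> {0..1}" "\<And>b. q b \<in> {0..1}"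
    "p True + p False = 2 * m" "q True + q False = 2 * m'"
    "p True * q True + p False * q False = 2 * (m * m' + c)"
    using c shared_bit_parameters by metis
  note A' = pos_semidef_2[OF A(1)] and B' = pos_semidef_2[OF B(1)]
  show thesis
  proof (rule that[OF pq(1,2)])
    show "bell_prob A (mat 1) = (p True + p False) / 2"
      by (simp add: pq bell_prob_def cinner_bell sum_2 mat_def m_def)
    show "bell_prob (mat 1) B = (q True + q False) / 2"
      by (simp add: pq bell_prob_def cinner_bell sum_2 mat_def m'_def)
    show "bell_prob A B = (p True * q True + p False * q False) / 2"
      unfolding pq(5) using A' B'
      by (simp add: bell_prob_def cinner_bell sum_2 m_def m'_def c_def x_def x'_def field_simps)
  qed
qed

section \<open>Probability mass functions on the signs\<close>

lemma finite_signs: "finite signs"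
  by (simp add: signs_def)

lemma pmf_eq_on_support:
  assumes "set_pmf P \<subseteq> A" "set_pmf Q \<subseteq> A" "\<And>x. x \<in> A \<Longrightarrow> pmf P x = pmf Q x"
  shows "P = Q"
proof (rule pmf_eqI)
  fix x show "pmf P x = pmf Q x"
  proof (cases "x \<in> A")
    case False
    then have "x \<notin> set_pmf P" "x \<notin> set_pmf Q" using assms(1,2) by blast+
    then show ?thesis by (simp add: set_pmf_iff)
  qed (rule assms(3))
qed

lemma pmf_bind_pair_finite_support:
  assumes "finite S" "set_pmf M \<subseteq> S"
  shows "pmf (bind_pmf M (\<lambda>m. pair_pmf (F m) (G m))) (u, v)
    = (\<Sum>m\<in>S. pmf M m * (pmf (F m) u * pmf (G m) v))"
  unfolding pmf_bind pmf_pair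
  using assms by (subst integral_measure_pmf_real[of S]) (auto simp: mult_ac)

lemma sign_pmf_sum:
  assumes "set_pmf P \<subseteq> signs"
  shows "pmf P 1 + pmf P (-1) = 1"
  using sum_pmf_eq_1[OF finite_signs assms] by (simp add: signs_def)

definition sign_pmf :: "real \<Rightarrow> int pmf" where
  "sign_pmf r = map_pmf (\<lambda>b. if b then 1 else -1) (bernoulli_pmf r)"

lemma set_sign_pmf: "set_pmf (sign_pmf r) \<subseteq> signs"
  by (auto simp: sign_pmf_def signs_def)

lemma pmf_sign_pmf:
  assumes "r \<in> {0..1}"
  shows "pmf (sign_pmf r) 1 = r" "pmf (sign_pmf r) (-1) = 1 - r"
proof -
  have "pmf (sign_pmf r) (if True then 1 else -1) = pmf (bernoulli_pmf r) True"
    unfolding sign_pmf_def by (rule pmf_map_inj') (auto intro!: injI split: if_splits)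
  then show "pmf (sign_pmf r) 1 = r" using assms by simp
  then show "pmf (sign_pmf r) (-1) = 1 - r"
    using sign_pmf_sum[OF set_sign_pmf, of r] by linarith
qed

lemma set_outcome_law:
  assumes "finite Z" "L1 \<in> measurements Z" "L2 \<in> measurements Z"
  shows "set_pmf (outcome_law Z L1 L2) \<subseteq> Z \<times> Z"
  using pmf_outcome_law[OF assms] by (auto simp: set_pmf_iff split: if_splits)

text \<open>A law on pairs of signs is determined by its two marginals and the probability of
  \<open>(1, 1)\<close>, so matching these three numbers with a shared bit matches the whole
  law.\<close>

lemma measurement_shared_bit:
  assumes L1: "L1 \<in> measurements signs" and L2: "L2 \<in> measurements signs"
    and F: "\<And>z. z \<in> signs \<Longrightarrow> set_pmf (F z) \<subseteq> signs"
    and G: "\<And>z. z \<in> signs \<Longrightarrow> set_pmf (G z) \<subseteq> signs"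
  obtains F' G' :: "int \<Rightarrow> int pmf"
  where "\<And>z. set_pmf (F' z) \<subseteq> signs" "\<And>z. set_pmf (G' z) \<subseteq> signs"
    "bind_pmf (outcome_law signs L1 L2) (\<lambda>(z1, z2). pair_pmf (F z1) (G z2)) =
     bind_pmf (pmf_of_set signs) (\<lambda>z. pair_pmf (F' z) (G' z))"
proof -
  \<comment> \<open>Postprocessing is moved into the measurement: \<open>A u\<close> is the effect
    for the final output \<open>u\<close>, and bilinearity makes
    \<open>bell_prob (A u) (B v)\<close> the joint law.\<close>
  define A where "A u = pmf (F 1) u *\<^sub>R L1 1 + pmf (F (-1)) u *\<^sub>R L1 (-1)" for u
  define B where "B v = pmf (G 1) v *\<^sub>R L2 1 + pmf (G (-1)) v *\<^sub>R L2 (-1)" for v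
  have L: "pos_semidef (L1 1)" "pos_semidef (L1 (-1))" "L1 1 + L1 (-1) = mat 1"
     "pos_semidef (L2 1)" "pos_semidef (L2 (-1))" "L2 1 + L2 (-1) = mat 1"
    using L1 L2 by (simp_all add: measurements_def signs_def add.commute)
  have psd: "pos_semidef (A u)" "pos_semidef (B u)" for u
    unfolding A_def B_def by (intro pos_semidef_add pos_semidef_scaleR L pmf_nonneg)+
  have "A 1 + A (-1) = (pmf (F 1) 1 + pmf (F 1) (-1)) *\<^sub>R L1 1
      + (pmf (F (-1)) 1 + pmf (F (-1)) (-1)) *\<^sub>R L1 (-1)"
    "B 1 + B (-1) = (pmf (G 1) 1 + pmf (G 1) (-1)) *\<^sub>R L2 1
      + (pmf (G (-1)) 1 + pmf (G (-1)) (-1)) *\<^sub>R L2 (-1)"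
    by (simp_all add: A_def B_def scaleR_left_distrib)
  \<comment> \<open>Each kernel has total mass one on the signs, so the new effects again sum to the
    identity.\<close>
  then have "A 1 + A (-1) = mat 1" "B 1 + B (-1) = mat 1"
    using sign_pmf_sum[OF F, of 1] sign_pmf_sum[OF F, of "-1"]
      sign_pmf_sum[OF G, of 1] sign_pmf_sum[OF G, of "-1"] L(3,6)
    by (simp_all add: signs_def)
  then have "A (-1) = mat 1 - A 1" "B (-1) = mat 1 - B 1"
    by (simp_all add: eq_diff_eq add.commute)
  note compl = this
  obtain p q where pq: "\<And>b. p b \<in> {0..1}" "\<And>b. q b \<in> {0..1}"
    "bell_prob (A 1) (mat 1) = (p True + p False) / 2"
    "bell_prob (mat 1) (B 1) = (q True + q False) / 2"
    "bell_prob (A 1) (B 1) = (p True * q True + p False * q False) / 2"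
    using bell_prob_effects_shared_bit[of "A 1" "B 1"] psd compl by metis
  define F' where "F' z = sign_pmf (p (z = 1))" for z :: int
  define G' where "G' z = sign_pmf (q (z = 1))" for z :: int
  note pmf_FG' = pmf_sign_pmf[OF pq(1)] pmf_sign_pmf[OF pq(2)]
  define R where "R = bind_pmf (outcome_law signs L1 L2) (\<lambda>(z1, z2). pair_pmf (F z1) (G z2))"
  define S where "S = bind_pmf (pmf_of_set signs) (\<lambda>z. pair_pmf (F' z) (G' z))"
  have setF': "set_pmf (F' z) \<subseteq> signs" and setG': "set_pmf (G' z) \<subseteq> signs" for z
    by (simp_all add: F'_def G'_def set_sign_pmf)
  note outcomes = set_outcome_law[OF finite_signs L1 L2]
  have "R = bind_pmf (outcome_law signs L1 L2) (\<lambda>z. pair_pmf (F (fst z)) (G (snd z)))"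
    by (simp add: R_def case_prod_beta')
  then have R: "pmf R (u, v) = bell_prob (A u) (B v)" for u v
    using pmf_bind_pair_finite_support[OF finite_cartesian_product[OF finite_signs finite_signs] outcomes,
        of "\<lambda>z. F (fst z)" "\<lambda>z. G (snd z)" u v]
    by (simp add: pmf_outcome_law[OF finite_signs L1 L2, unfolded signs_def] signs_def A_def B_def bell_prob_add_left
        bell_prob_add_right bell_prob_scaleR_left bell_prob_scaleR_right algebra_simps
        flip: sum.cartesian_product)
  have S: "pmf S (u, v) = (pmf (F' 1) u * pmf (G' 1) v + pmf (F' (-1)) u * pmf (G' (-1)) v) / 2"
    for u v
    unfolding S_def
    by (subst pmf_bind_pair_finite_support[of signs]) (auto simp: signs_def add_divide_distrib)
  \<comment> \<open>Inclusion-exclusion recovers the remaining three probabilities from the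
    marginals and the \<open>(1, 1)\<close> entry.\<close>
  have "bell_prob (A 1) (B (-1)) = bell_prob (A 1) (mat 1) - bell_prob (A 1) (B 1)"
    "bell_prob (A (-1)) (B 1) = bell_prob (mat 1) (B 1) - bell_prob (A 1) (B 1)"
    "bell_prob (A (-1)) (B (-1)) =
       1 - bell_prob (A 1) (mat 1) - bell_prob (mat 1) (B 1) + bell_prob (A 1) (B 1)"
    unfolding compl by (simp_all add: bell_prob_def cinner_bell sum_2 mat_def field_simps)
  note bell = this
  have "R = S"
  proof (rule pmf_eq_on_support[of _ "signs \<times> signs"])
    show "set_pmf R \<subseteq> signs \<times> signs"
      using outcomes F G by (fastforce simp: R_def)
    show "set_pmf S \<subseteq> signs \<times> signs"
      using setF' setG' by (fastforce simp: S_def)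
    fix uv assume "uv \<in> signs \<times> signs"
    then show "pmf R uv = pmf S uv"
      by (auto simp: signs_def R S bell F'_def G'_def pmf_FG' pq(3-5) field_simps)
  qed
  then show thesis
    using that[OF setF' setG'] by (simp add: R_def S_def)
qed

section \<open>Product sources as private randomness\<close>

text \<open>In the induction step the two sides differ only in the order of independent draws: the
  new sample from \<open>Q\<close> has to move past the remaining samples from
  \<open>P\<close>.\<close>

lemma replicate_pmf_pair:
  "map_pmf (\<lambda>xs. (map fst xs, map snd xs)) (replicate_pmf n (pair_pmf P Q)) =
   pair_pmf (replicate_pmf n P) (replicate_pmf n Q)"
proof (induction n)
  case 0
  then show ?case by (simp add: pair_return_pmf1)
next
  case (Suc n)
  have "map_pmf (\<lambda>xs. (map fst xs, map snd xs)) (replicate_pmf (Suc n) (pair_pmf P Q)) =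
    bind_pmf (pair_pmf P Q) (\<lambda>z. map_pmf (\<lambda>(a, b). (fst z # a, snd z # b))
      (map_pmf (\<lambda>xs. (map fst xs, map snd xs)) (replicate_pmf n (pair_pmf P Q))))"
    by (simp add: map_bind_pmf map_pmf_def bind_assoc_pmf bind_return_pmf)
  also have "\<dots> = pair_pmf (replicate_pmf (Suc n) P) (replicate_pmf (Suc n) Q)"
    unfolding Suc
    by (simp add: pair_pmf_def map_pmf_def bind_assoc_pmf bind_return_pmf)
       (subst bind_commute_pmf[of Q], rule refl)
  finally show ?case .
qed

text \<open>Given the outcomes, the two input blocks are independent, so each party averages over
  its own block and the source is absorbed into local kernels.\<close>

lemma EA_law_product:
  "EA_law (pair_pmf P Q) Z d L1 L2 f g =
   bind_pmf (outcome_law Z L1 L2) (\<lambda>(z1, z2).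
     pair_pmf (bind_pmf (replicate_pmf d P) (\<lambda>x. f (z1, x)))
              (bind_pmf (replicate_pmf d Q) (\<lambda>y. g (z2, y))))"
proof -
  have avg: "bind_pmf (replicate_pmf d (pair_pmf P Q))
      (\<lambda>xys. pair_pmf (f (z1, map fst xys)) (g (z2, map snd xys))) =
     pair_pmf (bind_pmf (replicate_pmf d P) (\<lambda>x. f (z1, x)))
              (bind_pmf (replicate_pmf d Q) (\<lambda>y. g (z2, y)))" (is "?l = ?r") for z1 z2
  proof -
    have "?l = bind_pmf (map_pmf (\<lambda>xs. (map fst xs, map snd xs)) (replicate_pmf d (pair_pmf P Q)))
        (\<lambda>(x, y). pair_pmf (f (z1, x)) (g (z2, y)))"
      by (simp add: bind_map_pmf)
    also have "\<dots> = ?r"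
      unfolding replicate_pmf_pair
      by (simp add: pair_pmf_def bind_assoc_pmf bind_return_pmf)
         (subst bind_commute_pmf[of "replicate_pmf d Q"], rule refl)
    finally show ?thesis .
  qed
  show ?thesis
    unfolding EA_law_def pair_pmf_def[of "outcome_law Z L1 L2"]
    by (simp add: bind_assoc_pmf bind_return_pmf case_prod_beta' avg)
qed

text \<open>The shared bit is the head of each input list. Strategies that read only the head let
  the source integrate out to total mass one.\<close>

lemma CR_law_only_bit:
  "CR_law P d (\<lambda>xs. F (hd xs)) (\<lambda>ys. G (hd ys)) =
   bind_pmf (pmf_of_set signs) (\<lambda>z. pair_pmf (F z) (G z))"
  by (simp add: CR_law_def pair_pmf_def[of "pmf_of_set signs"] bind_assoc_pmf bind_return_pmf)

lemma set_replicate_pmf_signs: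
  assumes "P \<in> distributions_on signs"
  shows "set_pmf (replicate_pmf d P) \<subseteq> sign_seqs d"
  using assms by (auto simp: set_replicate_pmf distributions_on_def sign_seqs_def)

text \<open>Absorbing the source and replacing the measurements by a bit are both exact at every
  fixed \<open>d\<close>, so no approximation enters the later limit.\<close>

lemma EA_law_as_CR_law:
  assumes P: "P \<in> distributions_on signs" and Q: "Q \<in> distributions_on signs"
    and L: "L1 \<in> measurements signs" "L2 \<in> measurements signs"
    and f: "f \<in> stochastic_functions (signs \<times> sign_seqs d) signs"
    and g: "g \<in> stochastic_functions (signs \<times> sign_seqs d) signs"
  shows "\<exists>f' \<in> stochastic_functions (sign_seqs (d + 1)) signs.
    \<exists>g' \<in> stochastic_functions (sign_seqs (d + 1)) signs.
      EA_law (pair_pmf P Q) signs d L1 L2 f g = CR_law (pair_pmf P Q) d f' g'"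
proof -
  let ?F = "\<lambda>z. bind_pmf (replicate_pmf d P) (\<lambda>x. f (z, x))"
    and ?G = "\<lambda>z. bind_pmf (replicate_pmf d Q) (\<lambda>y. g (z, y))"
  \<comment> \<open>The kernels are constrained only on sign sequences, and the block laws of
    \<open>P\<close> and \<open>Q\<close> are supported there.\<close>
  have "set_pmf (?F z) \<subseteq> signs" "set_pmf (?G z) \<subseteq> signs" if "z \<in> signs" for z
    using that f g set_replicate_pmf_signs[OF P, of d] set_replicate_pmf_signs[OF Q, of d]
    by (fastforce simp: stochastic_functions_def distributions_on_def)+
  note supp = this
  obtain F G where
    FG: "\<And>z. set_pmf (F z) \<subseteq> signs" "\<And>z. set_pmf (G z) \<subseteq> signs"
    "bind_pmf (outcome_law signs L1 L2) (\<lambda>(z1, z2). pair_pmf (?F z1) (?G z2)) =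
     bind_pmf (pmf_of_set signs) (\<lambda>z. pair_pmf (F z) (G z))"
    by (rule measurement_shared_bit[OF L, of ?F ?G], erule supp(1), erule supp(2), rule)
  show ?thesis
  proof (intro bexI)
    show "EA_law (pair_pmf P Q) signs d L1 L2 f g =
        CR_law (pair_pmf P Q) d (\<lambda>xs. F (hd xs)) (\<lambda>ys. G (hd ys))"
      unfolding EA_law_product CR_law_only_bit by (rule FG(3))
  qed (use FG in \<open>simp_all add: stochastic_functions_def distributions_on_def\<close>)
qed

section \<open>A shared bit from the Bell state\<close>

text \<open>The projectors of the standard basis: outcome \<open>1\<close> selects index
  \<open>1\<close>, every other integer selects index \<open>0\<close>, which is \<open>2\<close> in
  the index type.\<close>

definition basis_measurement :: "int \<Rightarrow> complex ^ 2 ^ 2" where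
  "basis_measurement z = (\<chi> i j. if i = j \<and> (i = 1 \<longleftrightarrow> z = 1) then 1 else 0)"

lemma basis_measurement: "basis_measurement \<in> measurements signs"
proof -
  have "pos_semidef (basis_measurement z)" for z
    by (auto simp: pos_semidef_def hermitian_def basis_measurement_def cinner_def
        matrix_vector_mult_def sum_2)
  moreover have "(\<Sum>z\<in>signs. basis_measurement z) = mat 1"
    by (simp add: signs_def basis_measurement_def mat_def vec_eq_iff)
  ultimately show ?thesis by (simp add: measurements_def)
qed

text \<open>The entrywise product of two basis projectors sums to 1 if they agree and to 0
  otherwise; the Bell state halves this, giving two equal uniform outcomes.\<close>

lemma outcome_law_basis_measurement:
  "outcome_law signs basis_measurement basis_measurement =
   map_pmf (\<lambda>z. (z, z)) (pmf_of_set signs)"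
proof (rule pmf_eqI)
  fix zz :: "int \<times> int"
  obtain z1 z2 where zz: "zz = (z1, z2)" by (cases zz)
  have "pmf (map_pmf (\<lambda>z. (z, z)) (pmf_of_set signs)) (z1, z2) =
      (if z1 = z2 then pmf (pmf_of_set signs) z1 else 0)"
  proof (cases "z1 = z2")
    case True
    then show ?thesis
      using pmf_map_inj'[of "\<lambda>z. (z, z)" "pmf_of_set signs" z1] by (simp add: inj_def)
  next
    case False
    then have "(z1, z2) \<notin> set_pmf (map_pmf (\<lambda>z. (z, z)) (pmf_of_set signs))" by auto
    then have "pmf (map_pmf (\<lambda>z. (z, z)) (pmf_of_set signs)) (z1, z2) = 0"
      by (simp only: set_pmf_iff not_not)
    then show ?thesis using False by simp
  qed
  then show "pmf (outcome_law signs basis_measurement basis_measurement) zz =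
      pmf (map_pmf (\<lambda>z. (z, z)) (pmf_of_set signs)) zz"
    unfolding zz pmf_outcome_law[OF finite_signs basis_measurement basis_measurement]
    by (auto simp: signs_def bell_prob_def cinner_bell sum_2 basis_measurement_def
        indicator_def)
qed

text \<open>The equal outcomes act as the shared bit, which each party prepends to its own block;
  this works for every source \<open>P\<close>.\<close>

lemma CR_law_as_EA_law:
  "CR_law P d f g = EA_law P signs d basis_measurement basis_measurement
     (\<lambda>(z, xs). f (z # xs)) (\<lambda>(z, ys). g (z # ys))"
  unfolding CR_law_def EA_law_def outcome_law_basis_measurement
  by (simp add: pair_pmf_def[of "map_pmf _ _"] pair_pmf_def[of "pmf_of_set signs"]
      bind_assoc_pmf bind_return_pmf bind_map_pmf)

lemma stochastic_functions_Cons: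
  assumes "f \<in> stochastic_functions (sign_seqs (d + 1)) U"
  shows "(\<lambda>(z, xs). f (z # xs)) \<in> stochastic_functions (signs \<times> sign_seqs d) U"
  using assms by (auto simp: stochastic_functions_def sign_seqs_def)

section \<open>Equality of the two simulation classes\<close>

theorem proposition1:
  fixes P_X P_Y :: "int pmf"
  assumes "P_X \<in> distributions_on signs" and "P_Y \<in> distributions_on signs"
  shows "P_EA (pair_pmf P_X P_Y) signs signs signs = P_CR (pair_pmf P_X P_Y) signs signs"
proof (intro equalityI subsetI)
  fix R assume "R \<in> P_EA (pair_pmf P_X P_Y) signs signs (signs :: int set)"
  then obtain L1 L2 f g where R: "R \<in> distributions_on (signs \<times> signs)"
    and adm: "\<forall>d. L1 d \<in> measurements signs \<and> L2 d \<in> measurements signs \<and>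
      f d \<in> stochastic_functions (signs \<times> sign_seqs d) signs \<and>
      g d \<in> stochastic_functions (signs \<times> sign_seqs d) signs"
    and lim: "(\<lambda>d. d_TV (EA_law (pair_pmf P_X P_Y) signs d (L1 d) (L2 d) (f d) (g d)) R)
      \<longlonglongrightarrow> 0"
    unfolding P_EA_def by (elim CollectE conjE exE) rule
  \<comment> \<open>The laws agree for each \<open>d\<close>, so after choosing \<open>f'\<close>
    and \<open>g'\<close> the sequence of distances to \<open>R\<close> is unchanged.\<close>
  have "\<forall>d. \<exists>f' \<in> stochastic_functions (sign_seqs (d + 1)) signs.
      \<exists>g' \<in> stochastic_functions (sign_seqs (d + 1)) signs.
        EA_law (pair_pmf P_X P_Y) signs d (L1 d) (L2 d) (f d) (g d) =
        CR_law (pair_pmf P_X P_Y) d f' g'"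
    by (intro allI EA_law_as_CR_law assms) (simp_all add: adm)
  then obtain f' g' where
    "\<And>d. f' d \<in> stochastic_functions (sign_seqs (d + 1)) signs"
    "\<And>d. g' d \<in> stochastic_functions (sign_seqs (d + 1)) signs"
    "\<And>d. EA_law (pair_pmf P_X P_Y) signs d (L1 d) (L2 d) (f d) (g d) =
      CR_law (pair_pmf P_X P_Y) d (f' d) (g' d)"
    by metis
  with R lim show "R \<in> P_CR (pair_pmf P_X P_Y) signs signs"
    unfolding P_CR_def by auto
next
  fix R assume "R \<in> P_CR (pair_pmf P_X P_Y) signs (signs :: int set)"
  then obtain f g where R: "R \<in> distributions_on (signs \<times> signs)"
    and adm: "\<forall>d. f d \<in> stochastic_functions (sign_seqs (d + 1)) signs \<and>
      g d \<in> stochastic_functions (sign_seqs (d + 1)) signs"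
    and lim: "(\<lambda>d. d_TV (CR_law (pair_pmf P_X P_Y) d (f d) (g d)) R) \<longlonglongrightarrow> 0"
    unfolding P_CR_def by (elim CollectE conjE exE) rule
  \<comment> \<open>The same basis measurement serves both parties at every \<open>d\<close>; its
    outcome takes the place of the head of the input list.\<close>
  have "\<forall>d. basis_measurement \<in> measurements signs \<and> basis_measurement \<in> measurements signs \<and>
      (\<lambda>(z, xs). f d (z # xs)) \<in> stochastic_functions (signs \<times> sign_seqs d) signs \<and>
      (\<lambda>(z, ys). g d (z # ys)) \<in> stochastic_functions (signs \<times> sign_seqs d) signs"
    by (intro allI conjI basis_measurement stochastic_functions_Cons
        adm[rule_format, THEN conjunct1] adm[rule_format, THEN conjunct2])
  moreover note lim[unfolded CR_law_as_EA_law]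
  ultimately show "R \<in> P_EA (pair_pmf P_X P_Y) signs signs signs"
    unfolding P_EA_def using R
    by (intro CollectI conjI exI[of _ "\<lambda>_. basis_measurement"]
        exI[of _ "\<lambda>d (z, xs). f d (z # xs)"] exI[of _ "\<lambda>d (z, ys). g d (z # ys)"]) auto
qed

end
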